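(* Let $(A,\tau_\lambda,\alpha,\beta)$ be a BiHom-associative conformal algebra with product $p_\lambda q$, and let $R,S:A\to A$ be $\mathbb{C}$-linear maps that commute with $\alpha$ and $\beta$. Define operations on $A$ by $p\prec_\lambda q=p_\lambda S(q)$ and $p\succ_\lambda q=R(p)_\lambda q$ for all $p,q\in A$. If $(A,\alpha,\beta,R,S)$ is a Rota-Baxter system, then $(A,\prec_\lambda,\succ_\lambda,\alpha,\beta)$ is a BiHom-dendriform conformal algebra.
   Context: All vector spaces, linear maps and tensor products are over $\mathbb{C}$; $\lambda,\mu$ are formal variables. For a $\mathbb{C}[\partial]$-module $A$ put $A[\lambda]=\mathbb{C}[\lambda]\otimes A$. A $\mathbb{C}$-bilinear map $A\otimes A\to A[\lambda]$, $p\otimes q\mapsto p\circ_\lambda q$, is conformal sesquilinear if $(\partial p)\circ_\lambda q=-\lambda(p\circ_\lambda q)$ and $p\circ_\lambda(\partial q)=(\partial+\lambda)(p\circ_\lambda q)$. Linear maps and products are extended coefficientwise to polynomials in $\lambda,\mu$; e.g. if $p\circ_\lambda q=\sum_i\lambda^i a_i$ then $(p\circ_\lambda q)\circ_{\lambda+\mu}r=\sum_i\lambda^i(a_i\circ_{\lambda+\mu}r)$. A map $\alpha$ is multiplicative for $\circ_\lambda$ if $\alpha(p\circ_\lambda q)=\alpha(p)\circ_\lambda\alpha(q)$. A BiHom-associative conformal algebra $(A,\tau_\lambda,\alpha,\beta)$ is a $\mathbb{C}[\partial]$-module $A$ with a conformal sesquilinear map $\tau_\lambda:A\otimes A\to A[\lambda]$,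 $p\otimes q\mapsto p_\lambda q$, and commuting $\mathbb{C}$-linear maps $\alpha,\beta:A\to A$ commuting with $\partial$ and multiplicative, such that $\alpha(p)_\lambda(q_\mu r)=(p_\lambda q)_{\lambda+\mu}\beta(r)$. A Rota-Baxter system $(A,\alpha,\beta,R,S)$ on a BiHom-associative conformal algebra $(A,\tau_\lambda,\alpha,\beta)$ consists of $\mathbb{C}[\partial]$-module morphisms $R,S:A\to A$ commuting with $\alpha$ and $\beta$ such that $R(p)_\lambda R(q)=R(R(p)_\lambda q+p_\lambda S(q))$ and $S(p)_\lambda S(q)=S(R(p)_\lambda q+p_\lambda S(q))$ for all $p,q\in A$. A BiHom-dendriform conformal algebra $(A,\prec_\lambda,\succ_\lambda,\alpha,\beta)$ is a $\mathbb{C}[\partial]$-module $A$ with conformal sesquilinear maps $\prec_\lambda,\succ_\lambda:A\otimes A\to A[\lambda]$ and commuting $\mathbb{C}$-linear maps $\alpha,\beta:A\to A$ commuting with $\partial$ and multiplicative for both products, such that for all $p,q,r\in A$: $(p\prec_\lambda q)\prec_{\lambda+\mu}\beta(r)=\alpha(p)\prec_\lambda(q\prec_\mu r+q\succ_\mu r)$; $(p\succ_\lambda q)\prec_{\lambda+\mu}\beta(r)=\alpha(p)\succ_\lambda(q\prec_\mu r)$; $\alpha(p)\succ_\lambda(q\succ_\mu r)=(p\prec_\lambda q+p\succ_\lambda q)\succ_{\lambda+\mu}\beta(r)$. *)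

theory Defs
  imports "HOL-Computational_Algebra.Polynomial"
begin

text \<open>
  A module over \<open>\<complex>[\<partial>]\<close> is a module (in the sense of the locale \<^locale>\<open>module\<close>) with scalars of
  type \<^typ>\<open>complex poly\<close>; the polynomial variable plays the role of \<open>\<partial>\<close>.
  The space \<open>A[\<lambda>]\<close> is the type \<open>'a poly\<close>, which only needs a zero in \<open>'a\<close>.
  The space \<open>A[\<lambda>, \<mu>]\<close> is \<open>'a poly poly\<close>, with \<open>\<lambda>\<close> the inner and \<open>\<mu>\<close> the outer variable.
  The coefficientwise extension of a linear map is \<^const>\<open>map_poly\<close>, and multiplication by
  the variable is \<open>pCons 0\<close>.
\<close>

definition del :: "(complex poly \<Rightarrow> 'a \<Rightarrow> 'a) \<Rightarrow> 'a \<Rightarrow> 'a" where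
  "del s = s [:0, 1:]"

definition cscale :: "(complex poly \<Rightarrow> 'a \<Rightarrow> 'a) \<Rightarrow> complex \<Rightarrow> 'a \<Rightarrow> 'a" where
  "cscale s c = s [:c:]"

definition poly_cscale ::
    "(complex poly \<Rightarrow> 'a::ab_group_add \<Rightarrow> 'a) \<Rightarrow> complex \<Rightarrow> 'a poly \<Rightarrow> 'a poly" where
  "poly_cscale s c = map_poly (cscale s c)"

locale conformal_sesquilinear = module s
  for s :: "complex poly \<Rightarrow> 'a::ab_group_add \<Rightarrow> 'a" +
  fixes m :: "'a \<Rightarrow> 'a \<Rightarrow> 'a poly"
  assumes linear_left: "Vector_Spaces.linear (cscale s) (poly_cscale s) (\<lambda>p. m p q)"
    and linear_right: "Vector_Spaces.linear (cscale s) (poly_cscale s) (\<lambda>q. m p q)"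
    and del_left: "m (del s p) q = - pCons 0 (m p q)"
    and del_right: "m p (del s q) = map_poly (del s) (m p q) + pCons 0 (m p q)"

definition multiplicative :: "('a::ab_group_add \<Rightarrow> 'a \<Rightarrow> 'a poly) \<Rightarrow> ('a \<Rightarrow> 'a) \<Rightarrow> bool" where
  "multiplicative m f \<longleftrightarrow> (\<forall>p q. map_poly f (m p q) = m (f p) (f q))"

definition mult_lam :: "'a::ab_group_add poly poly \<Rightarrow> 'a poly poly" where
  "mult_lam = map_poly (pCons 0)"

definition mult_mu :: "'a::ab_group_add poly poly \<Rightarrow> 'a poly poly" where
  "mult_mu = pCons 0"

text \<open>Substitution of \<open>\<lambda> + \<mu>\<close> for the variable: \<open>\<Sum>\<^sub>k (\<lambda> + \<mu>)\<^sup>k c\<^sub>k\<close>.\<close>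

definition at_lam_plus_mu :: "'a::ab_group_add poly \<Rightarrow> 'a poly poly" where
  "at_lam_plus_mu f =
     (\<Sum>k\<le>degree f. ((\<lambda>g. mult_lam g + mult_mu g) ^^ k) [:[:coeff f k:]:])"

text \<open>
  For \<open>f = \<Sum>\<^sub>i \<lambda>\<^sup>i a\<^sub>i\<close>, the element \<open>f \<circ>\<^bsub>\<lambda>+\<mu>\<^esub> r = \<Sum>\<^sub>i \<lambda>\<^sup>i (a\<^sub>i \<circ>\<^bsub>\<lambda>+\<mu>\<^esub> r)\<close>.
\<close>

definition prod_lam_plus_mu ::
    "('a::ab_group_add \<Rightarrow> 'a \<Rightarrow> 'a poly) \<Rightarrow> 'a poly \<Rightarrow> 'a \<Rightarrow> 'a poly poly" where
  "prod_lam_plus_mu m f r =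
     (\<Sum>i\<le>degree f. (mult_lam ^^ i) (at_lam_plus_mu (m (coeff f i) r)))"

text \<open>
  For \<open>g = \<Sum>\<^sub>j \<mu>\<^sup>j b\<^sub>j\<close>, the element \<open>p \<circ>\<^sub>\<lambda> g = \<Sum>\<^sub>j \<mu>\<^sup>j (p \<circ>\<^sub>\<lambda> b\<^sub>j)\<close>.
\<close>

definition prod_lam ::
    "('a::ab_group_add \<Rightarrow> 'a \<Rightarrow> 'a poly) \<Rightarrow> 'a \<Rightarrow> 'a poly \<Rightarrow> 'a poly poly" where
  "prod_lam m p g = map_poly (m p) g"

locale bihom_structure_maps = module s
  for s :: "complex poly \<Rightarrow> 'a::ab_group_add \<Rightarrow> 'a" +
  fixes \<alpha> \<beta> :: "'a \<Rightarrow> 'a"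
  assumes linear_alpha: "Vector_Spaces.linear (cscale s) (cscale s) \<alpha>"
    and linear_beta: "Vector_Spaces.linear (cscale s) (cscale s) \<beta>"
    and alpha_beta: "\<alpha> (\<beta> p) = \<beta> (\<alpha> p)"
    and alpha_del: "\<alpha> (del s p) = del s (\<alpha> p)"
    and beta_del: "\<beta> (del s p) = del s (\<beta> p)"

locale bihom_assoc_conformal_algebra =
  conformal_sesquilinear s \<tau> + bihom_structure_maps s \<alpha> \<beta>
  for s :: "complex poly \<Rightarrow> 'a::ab_group_add \<Rightarrow> 'a"
    and \<tau> :: "'a \<Rightarrow> 'a \<Rightarrow> 'a poly"
    and \<alpha> \<beta> :: "'a \<Rightarrow> 'a" +
  assumes multiplicative_alpha: "multiplicative \<tau> \<alpha>"
    and multiplicative_beta: "multiplicative \<tau> \<beta>"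
    and bihom_assoc: "prod_lam \<tau> (\<alpha> p) (\<tau> q r) = prod_lam_plus_mu \<tau> (\<tau> p q) (\<beta> r)"

locale rota_baxter_system =
  bihom_assoc_conformal_algebra s \<tau> \<alpha> \<beta>
  for s :: "complex poly \<Rightarrow> 'a::ab_group_add \<Rightarrow> 'a"
    and \<tau> :: "'a \<Rightarrow> 'a \<Rightarrow> 'a poly"
    and \<alpha> \<beta> :: "'a \<Rightarrow> 'a" +
  fixes R S :: "'a \<Rightarrow> 'a"
  assumes hom_R: "module_hom s s R"
    and hom_S: "module_hom s s S"
    and R_alpha: "R (\<alpha> p) = \<alpha> (R p)"
    and R_beta: "R (\<beta> p) = \<beta> (R p)"
    and S_alpha: "S (\<alpha> p) = \<alpha> (S p)"
    and S_beta: "S (\<beta> p) = \<beta> (S p)"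
    and rota_baxter_R: "\<tau> (R p) (R q) = map_poly R (\<tau> (R p) q + \<tau> p (S q))"
    and rota_baxter_S: "\<tau> (S p) (S q) = map_poly S (\<tau> (R p) q + \<tau> p (S q))"

locale bihom_dendriform_conformal_algebra =
  left: conformal_sesquilinear s prec + right: conformal_sesquilinear s succ +
  bihom_structure_maps s \<alpha> \<beta>
  for s :: "complex poly \<Rightarrow> 'a::ab_group_add \<Rightarrow> 'a"
    and prec succ :: "'a \<Rightarrow> 'a \<Rightarrow> 'a poly"
    and \<alpha> \<beta> :: "'a \<Rightarrow> 'a" +
  assumes multiplicative_prec_alpha: "multiplicative prec \<alpha>"
    and multiplicative_prec_beta: "multiplicative prec \<beta>"
    and multiplicative_succ_alpha: "multiplicative succ \<alpha>"
    and multiplicative_succ_beta: "multiplicative succ \<beta>"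
    and dendriform_prec_prec:
      "prod_lam_plus_mu prec (prec p q) (\<beta> r) = prod_lam prec (\<alpha> p) (prec q r + succ q r)"
    and dendriform_succ_prec:
      "prod_lam_plus_mu prec (succ p q) (\<beta> r) = prod_lam succ (\<alpha> p) (prec q r)"
    and dendriform_succ_succ:
      "prod_lam succ (\<alpha> p) (succ q r) = prod_lam_plus_mu succ (prec p q + succ p q) (\<beta> r)"

end

theory Submission
  imports Defs
begin

text \<open>
  Both new products arise from \<open>\<tau>\<close> by precomposition: they have the form
  \<open>\<lambda>p q. \<tau> (f p) (g q)\<close> with \<open>(f, g) = (id, S)\<close> for \<open>\<prec>\<close> and \<open>(f, g) = (R, id)\<close> for \<open>\<succ>\<close>. If \<open>f\<close>
  and \<open>g\<close> are \<open>\<complex>[\<partial>]\<close>-linear, such a precomposition is again conformal sesquilinear, and structure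
  maps that commute with \<open>f\<close> and \<open>g\<close> stay multiplicative. In the iterated products, \<open>f\<close> and \<open>g\<close>
  can be moved onto the arguments (lemmas \<open>prod_lam_precompose\<close> and
  \<open>prod_lam_plus_mu_precompose\<close>). Each dendriform identity then becomes an instance of
  BiHom-associativity of \<open>\<tau>\<close>, at the triples
  \<open>(p, S q, S r)\<close>, \<open>(R p, q, S r)\<close> and \<open>(R p, R q, r)\<close> respectively: the Rota-Baxter identity for \<open>S\<close>
  turns \<open>S q \<^sub>\<mu> S r\<close> into \<open>S (q \<prec> r + q \<succ> r)\<close>, the one for \<open>R\<close> turns \<open>R p \<^sub>\<lambda> R q\<close> into
  \<open>R (p \<prec> q + p \<succ> q)\<close>, and the middle identity is BiHom-associativity as it stands.
  Throughout, \<open>R (\<alpha> p) = \<alpha> (R p)\<close> and \<open>S (\<beta> r) = \<beta> (S r)\<close> bring the outer arguments into the form that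
  BiHom-associativity requires.
\<close>

lemma at_lam_plus_mu_0 [simp]: "at_lam_plus_mu 0 = 0"
  by (simp add: at_lam_plus_mu_def)

lemma mult_lam_power_0 [simp]: "(mult_lam ^^ i) 0 = 0"
  by (induction i) (simp_all add: mult_lam_def)

lemma prod_lam_precompose:
  assumes "g 0 = 0" and "m (f p) 0 = 0"
  shows "prod_lam (\<lambda>p q. m (f p) (g q)) p h = prod_lam m (f p) (map_poly g h)"
  by (simp add: prod_lam_def map_poly_map_poly assms o_def)

text \<open>
  The two sides are sums over different ranges, since \<open>f\<close> may kill the leading coefficients
  of \<open>h\<close>; the surplus summands vanish because \<open>m 0 = 0\<close>.
\<close>

lemma prod_lam_plus_mu_precompose:
  assumes f0: "f 0 = 0" and m0: "\<And>x. m 0 x = 0"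
  shows "prod_lam_plus_mu (\<lambda>p q. m (f p) (g q)) h r = prod_lam_plus_mu m (map_poly f h) (g r)"
proof -
  let ?t = "\<lambda>i. (mult_lam ^^ i) (at_lam_plus_mu (m (coeff (map_poly f h) i) (g r)))"
  have "(\<Sum>i\<le>degree (map_poly f h). ?t i) = (\<Sum>i\<le>degree h. ?t i)"
  proof (rule sum.mono_neutral_left)
    show "{..degree (map_poly f h)} \<subseteq> {..degree h}"
      using map_poly_degree_leq[of f h] by auto
    show "\<forall>i\<in>{..degree h} - {..degree (map_poly f h)}. ?t i = 0"
      by (simp add: coeff_eq_0 m0)
  qed simp
  then show ?thesis
    by (simp add: prod_lam_plus_mu_def coeff_map_poly f0)
qed

lemma multiplicative_precompose:
  assumes "multiplicative m h" and "\<And>p. f (h p) = h (f p)" and "\<And>q. g (h q) = h (g q)"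
  shows "multiplicative (\<lambda>p q. m (f p) (g q)) h"
  using assms by (simp add: multiplicative_def)

context conformal_sesquilinear
begin

lemma zero_left [simp]: "m 0 q = 0"
  using linear_left by (metis Vector_Spaces.linear.axioms(3) module_hom.zero)

lemma zero_right [simp]: "m p 0 = 0"
  using linear_right by (metis Vector_Spaces.linear.axioms(3) module_hom.zero)

lemma linear_cscale_if_module_hom:
  assumes "module_hom s s f"
  shows "Vector_Spaces.linear (cscale s) (cscale s) f"
proof -
  interpret f: module_hom s s f by fact
  have "vector_space (cscale s)"
    using linear_left by (rule Vector_Spaces.linear.axioms(1))
  then show ?thesis
    by (simp add: linear_iff_module_hom module_hom_def module_hom_axioms_def
        module_iff_vector_space f.add f.scale cscale_def)
qed

lemma conformal_sesquilinear_precompose: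
  assumes f: "module_hom s s f" and g: "module_hom s s g"
  shows "conformal_sesquilinear s (\<lambda>p q. m (f p) (g q))"
proof (intro conformal_sesquilinear.intro conformal_sesquilinear_axioms.intro)
  show "module s" by (rule module_axioms)
  fix p q
  show "Vector_Spaces.linear (cscale s) (poly_cscale s) (\<lambda>p. m (f p) (g q))"
    using Vector_Spaces.linear_compose[OF linear_cscale_if_module_hom[OF f] linear_left] by (simp add: o_def)
  show "Vector_Spaces.linear (cscale s) (poly_cscale s) (\<lambda>q. m (f p) (g q))"
    using Vector_Spaces.linear_compose[OF linear_cscale_if_module_hom[OF g] linear_right] by (simp add: o_def)
  have "f (del s p) = del s (f p)" "g (del s q) = del s (g q)"
    using f g by (simp_all add: del_def module_hom.scale)
  then show "m (f (del s p)) (g q) = - pCons 0 (m (f p) (g q))"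
    and "m (f p) (g (del s q)) =
      map_poly (del s) (m (f p) (g q)) + pCons 0 (m (f p) (g q))"
    by (simp_all add: del_left del_right)
qed

end

context rota_baxter_system
begin

lemma R_0: "R 0 = 0"
  using hom_R by (rule module_hom.zero)

lemma S_0: "S 0 = 0"
  using hom_S by (rule module_hom.zero)

text \<open>
  With \<open>f\<close> and \<open>g\<close> left schematic, the precomposition rules would match any product by
  higher-order unification; these instances make them usable as rewrite rules.
\<close>

lemmas prod_lam_prec = prod_lam_precompose[where m = \<tau> and f = "\<lambda>p. p" and g = S]
lemmas prod_lam_succ = prod_lam_precompose[where m = \<tau> and f = R and g = "\<lambda>q. q"]
lemmas prod_lam_plus_mu_prec =
  prod_lam_plus_mu_precompose[where m = \<tau> and f = "\<lambda>p. p" and g = S]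
lemmas prod_lam_plus_mu_succ =
  prod_lam_plus_mu_precompose[where m = \<tau> and f = R and g = "\<lambda>q. q"]

lemma bihom_dendriform:
  "bihom_dendriform_conformal_algebra s (\<lambda>p q. \<tau> p (S q)) (\<lambda>p q. \<tau> (R p) q) \<alpha> \<beta>"
proof (intro bihom_dendriform_conformal_algebra.intro
    bihom_dendriform_conformal_algebra_axioms.intro)
  show "conformal_sesquilinear s (\<lambda>p q. \<tau> p (S q))"
    by (rule conformal_sesquilinear_precompose[OF module_hom_ident hom_S])
  show "conformal_sesquilinear s (\<lambda>p q. \<tau> (R p) q)"
    by (rule conformal_sesquilinear_precompose[OF hom_R module_hom_ident])
  show "bihom_structure_maps s \<alpha> \<beta>"
    by (rule bihom_structure_maps_axioms)
  show "multiplicative (\<lambda>p q. \<tau> p (S q)) \<alpha>"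
    using multiplicative_precompose[OF multiplicative_alpha, of id S] by (simp add: S_alpha)
  show "multiplicative (\<lambda>p q. \<tau> p (S q)) \<beta>"
    using multiplicative_precompose[OF multiplicative_beta, of id S] by (simp add: S_beta)
  show "multiplicative (\<lambda>p q. \<tau> (R p) q) \<alpha>"
    using multiplicative_precompose[OF multiplicative_alpha, of R id] by (simp add: R_alpha)
  show "multiplicative (\<lambda>p q. \<tau> (R p) q) \<beta>"
    using multiplicative_precompose[OF multiplicative_beta, of R id] by (simp add: R_beta)
  fix p q r
  show "prod_lam_plus_mu (\<lambda>p q. \<tau> p (S q)) (\<tau> p (S q)) (\<beta> r) =
      prod_lam (\<lambda>p q. \<tau> p (S q)) (\<alpha> p) (\<tau> q (S r) + \<tau> (R q) r)"
    by (simp add: prod_lam_plus_mu_prec prod_lam_prec S_0 S_beta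
        bihom_assoc[symmetric] rota_baxter_S add.commute)
  show "prod_lam_plus_mu (\<lambda>p q. \<tau> p (S q)) (\<tau> (R p) q) (\<beta> r) =
      prod_lam (\<lambda>p q. \<tau> (R p) q) (\<alpha> p) (\<tau> q (S r))"
    by (simp add: prod_lam_plus_mu_prec prod_lam_succ S_beta R_alpha bihom_assoc)
  show "prod_lam (\<lambda>p q. \<tau> (R p) q) (\<alpha> p) (\<tau> (R q) r) =
      prod_lam_plus_mu (\<lambda>p q. \<tau> (R p) q) (\<tau> p (S q) + \<tau> (R p) q) (\<beta> r)"
    by (simp add: prod_lam_plus_mu_succ prod_lam_succ R_0 R_alpha
        bihom_assoc rota_baxter_R add.commute)
qed

end

theorem theorem5p5:
  fixes s :: "complex poly \<Rightarrow> 'a::ab_group_add \<Rightarrow> 'a"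
    and \<tau> prec succ :: "'a \<Rightarrow> 'a \<Rightarrow> 'a poly"
    and \<alpha> \<beta> R S :: "'a \<Rightarrow> 'a"
  assumes "bihom_assoc_conformal_algebra s \<tau> \<alpha> \<beta>"
    and "Vector_Spaces.linear (cscale s) (cscale s) R"
    and "Vector_Spaces.linear (cscale s) (cscale s) S"
    and "\<And>p. R (\<alpha> p) = \<alpha> (R p)" and "\<And>p. R (\<beta> p) = \<beta> (R p)"
    and "\<And>p. S (\<alpha> p) = \<alpha> (S p)" and "\<And>p. S (\<beta> p) = \<beta> (S p)"
    and "\<And>p q. prec p q = \<tau> p (S q)"
    and "\<And>p q. succ p q = \<tau> (R p) q"
    and "rota_baxter_system s \<tau> \<alpha> \<beta> R S"
  shows "bihom_dendriform_conformal_algebra s prec succ \<alpha> \<beta>"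
proof -
  have "prec = (\<lambda>p q. \<tau> p (S q))" and "succ = (\<lambda>p q. \<tau> (R p) q)"
    using assms(8,9) by (simp_all add: fun_eq_iff)
  then show ?thesis
    using rota_baxter_system.bihom_dendriform[OF assms(10)] by simp
qed

end
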